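(* For every integer $n \ge 3$, let $\phi_n$ be the integer-valued function on the set of all positive integers defined recursively by $\phi_n(m) = 2^m - 1$ for all $1 \le m \le n-1$ and $$\phi_n(n+k) = \sum_{j=1}^{n-1} \phi_n(n+k-j) \quad \text{for all integers } k \ge 0.$$ Then, for every positive integer $m$, $\Phi_1(m, \phi_n) \equiv 0 \pmod m$. Furthermore, $$\lim_{m \to \infty} \frac{\log \Phi_1(m, \phi_n)}{m} = \lim_{m \to \infty} \frac{\log \phi_n(m)}{m} = \log \alpha_n,$$ where $\alpha_n$ is the (unique) positive (and the largest in absolute value) zero of the polynomial $x^{n-1} - \sum_{k=0}^{n-2} x^k$.
   Context: For an integer-valued function $\phi$ defined on the set of all positive integers, $\Phi_1(m,\phi)$ is defined as follows. Set $\Phi_1(1,\phi) = \phi(1)$. If $m = p_1^{k_1}p_2^{k_2}\cdots p_r^{k_r}$, where the $p_i$ are distinct primes and $r$ and the $k_i$ are positive integers, set $$\Phi_1(m,\phi) = \phi(m) - \sum_{i=1}^r \phi\left(\frac{m}{p_i}\right) + \sum_{i_1<i_2}\phi\left(\frac{m}{p_{i_1}p_{i_2}}\right) - \sum_{i_1<i_2<i_3}\phi\left(\frac{m}{p_{i_1}p_{i_2}p_{i_3}}\right) + \cdots + (-1)^r\phi\left(\frac{m}{p_1p_2\cdots p_r}\right),$$ where each sum $\sum_{i_1<\cdots<i_j}$ is over all integers $i_1,\dots,i_j$ with $1\le i_1<i_2<\cdots<i_j\le r$. *)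

theory Defs
  imports
    Complex_Main
    "HOL-Computational_Algebra.Computational_Algebra"
    "HOL-Number_Theory.Cong"
begin

text \<open>
  A subset \<open>S\<close> of the prime factors of \<open>m\<close> with \<open>card S = j\<close> stands for a choice of indices
  \<open>i\<^sub>1 < \<dots> < i\<^sub>j\<close>; the summand for \<open>j = 0\<close> is \<open>\<phi> m\<close>. Only arguments \<open>m > 0\<close> are meaningful, and
  for these \<open>\<phi>\<close> is evaluated at positive arguments only.
\<close>

definition Phi1 :: "nat \<Rightarrow> (nat \<Rightarrow> int) \<Rightarrow> int" where
  "Phi1 m \<phi> =
     (\<Sum>j = 0..card (prime_factors m).
        (-1) ^ j * (\<Sum>S | S \<subseteq> prime_factors m \<and> card S = j. \<phi> (m div \<Prod>S)))"

text \<open>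
  The value at \<open>m = 0\<close> is a dummy: the recursion for \<open>m \<ge> n\<close> only reaches the indices
  \<open>m - n + 1, \<dots>, m - 1\<close>, which are positive.
\<close>

function phi :: "nat \<Rightarrow> nat \<Rightarrow> int" where
  "phi n m = (if m < n then 2 ^ m - 1 else (\<Sum>j = 1..n - 1. phi n (m - j)))"
  by auto
termination
  by (relation "measure snd") auto

declare phi.simps [simp del]

lemma phi_initial: "1 \<le> m \<Longrightarrow> m \<le> n - 1 \<Longrightarrow> phi n m = 2 ^ m - 1"
  by (subst phi.simps) auto

lemma phi_recurrence: "phi n (n + k) = (\<Sum>j = 1..n - 1. phi n (n + k - j))"
  by (subst phi.simps) auto

definition recurrence_poly :: "nat \<Rightarrow> 'a :: comm_ring_1 poly" where
  "recurrence_poly n = monom 1 (n - 1) - (\<Sum>k = 0..n - 2. monom 1 k)"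

end

theory Submission
  imports Defs "HOL-Real_Asymp.Real_Asymp"
begin

text \<open>
  The numbers \<open>\<phi>\<^sub>n(m)\<close> are the coefficients of \<open>- x f' / f\<close> for the integer polynomial
  \<open>f = 1 - x - \<dots> - x\<^bsup>n-1\<^esup>\<close>. Every integer power series with constant term 1 is a product
  \<open>\<Prod>\<^sub>d (1 - x\<^sup>d)\<^bsup>c d\<^esup>\<close> with integer exponents, and comparing logarithmic derivatives gives
  \<open>\<phi>\<^sub>n(m) = \<Sum>\<^bsub>d | m\<^esub> d c(d)\<close>; Moebius inversion turns this into \<open>\<Phi>\<^sub>1(m, \<phi>\<^sub>n) = m c(m)\<close>.
  For the growth rates, the recurrence keeps \<open>\<phi>\<^sub>n(m)\<close> between constant multiples of \<open>\<alpha>\<^sup>m\<close>, where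
  \<open>\<alpha> > 1\<close> is the positive root, while \<open>\<Phi>\<^sub>1(m, \<phi>\<^sub>n) - \<phi>\<^sub>n(m)\<close> is only \<open>O(m \<alpha>\<^bsup>m/2\<^esup>)\<close>.
\<close>

section \<open>Logarithmic derivatives of integer power series\<close>

text \<open>\<open>P\<close> is -x g'/g, written without division; that \<open>g\<close> has integer
  coefficients is what produces divisibility later.\<close>

definition neg_log_deriv :: "int fps \<Rightarrow> bool" where
  "neg_log_deriv P \<longleftrightarrow> (\<exists>g. fps_nth g 0 = 1 \<and> fps_X * fps_deriv g = - (g * P))"

lemma neg_log_deriv_0: "neg_log_deriv 0"
  unfolding neg_log_deriv_def by (rule exI[of _ 1]) simp

text \<open>The logarithmic derivative turns products into sums, so \<open>g * h\<close> is a
  witness.\<close>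

lemma neg_log_deriv_add:
  assumes "neg_log_deriv P" "neg_log_deriv Q"
  shows "neg_log_deriv (P + Q)"
proof -
  obtain g h where g: "fps_nth g 0 = 1" "fps_X * fps_deriv g = - (g * P)"
    and h: "fps_nth h 0 = 1" "fps_X * fps_deriv h = - (h * Q)"
    using assms unfolding neg_log_deriv_def by blast
  have "fps_X * fps_deriv (g * h) = g * (fps_X * fps_deriv h) + h * (fps_X * fps_deriv g)"
    by (simp add: algebra_simps)
  also have "\<dots> = - (g * h * (P + Q))"
    by (simp add: g h algebra_simps)
  finally show ?thesis
    using g h unfolding neg_log_deriv_def by (intro exI[of _ "g * h"]) simp
qed

text \<open>The witness is the reciprocal of \<open>g\<close>, again an integer series because the
  constant term of \<open>g\<close> is 1.\<close>

lemma neg_log_deriv_uminus: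
  assumes "neg_log_deriv P"
  shows "neg_log_deriv (- P)"
proof -
  obtain g where g: "fps_nth g 0 = 1" "fps_X * fps_deriv g = - (g * P)"
    using assms unfolding neg_log_deriv_def by blast
  define h where "h = fps_right_inverse g 1"
  have gh: "g * h = 1"
    unfolding h_def by (rule fps_right_inverse) (simp add: g)
  have "g * fps_deriv h + fps_deriv g * h = fps_deriv (g * h)"
    by simp
  also have "\<dots> = 0"
    by (simp add: gh)
  finally have "g * fps_deriv h = - (fps_deriv g * h)"
    by (simp add: add_eq_0_iff2)
  hence "fps_X * fps_deriv h * (g * h) = - (fps_X * fps_deriv g * h * h)"
    by (metis (no_types, lifting) mult.assoc mult.commute mult_minus_right)
  also have "\<dots> = P * h * (g * h)"
    by (simp add: g algebra_simps)
  finally have "fps_X * fps_deriv h = - (h * (- P))"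
    by (simp add: gh mult.commute)
  moreover have "fps_nth h 0 = 1"
    by (simp add: h_def)
  ultimately show ?thesis
    unfolding neg_log_deriv_def by blast
qed

lemma neg_log_deriv_diff:
  assumes "neg_log_deriv P" "neg_log_deriv Q"
  shows "neg_log_deriv (P - Q)"
  using neg_log_deriv_add[OF assms(1) neg_log_deriv_uminus[OF assms(2)]] by simp

lemma neg_log_deriv_of_int_mult:
  assumes "neg_log_deriv P"
  shows "neg_log_deriv (of_int c * P)"
proof -
  have nat: "neg_log_deriv (of_nat k * P)" for k
    by (induction k) (auto simp: neg_log_deriv_0 algebra_simps intro: neg_log_deriv_add assms)
  show ?thesis
  proof (cases c)
    case (nonneg k)
    thus ?thesis using nat[of k] by simp
  next
    case (neg k)
    have "of_int c * P = - (of_nat (Suc k) * P)"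
      unfolding neg by (simp add: algebra_simps)
    thus ?thesis using neg_log_deriv_uminus[OF nat[of "Suc k"]] by metis
  qed
qed

lemma neg_log_deriv_sum:
  assumes "\<And>x. x \<in> A \<Longrightarrow> neg_log_deriv (P x)"
  shows "neg_log_deriv (\<Sum>x\<in>A. P x)"
  using assms
  by (induction A rule: infinite_finite_induct) (auto simp: neg_log_deriv_0 intro: neg_log_deriv_add)

text \<open>The expansion of d x^d / (1 - x^d), which is -x g'/g for g = 1 - x^d. The condition
  \<open>m > 0\<close> is there because \<open>d\<close> divides 0.\<close>

definition lambert_fps :: "nat \<Rightarrow> int fps" where
  "lambert_fps d = Abs_fps (\<lambda>m. if m > 0 \<and> d dvd m then int d else 0)"

lemma neg_log_deriv_lambert_fps:
  assumes "d > 0"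
  shows "neg_log_deriv (lambert_fps d)"
proof -
  define g :: "int fps" where "g = 1 - fps_X ^ d"
  have "fps_X * fps_deriv g = - (g * lambert_fps d)"
  proof (rule fps_ext)
    fix m
    \<comment> \<open>Shifting by \<open>d\<close> preserves divisibility by \<open>d\<close>, so
      the series and its shifted copy cancel except at index \<open>d\<close>.\<close>
    have "d dvd m - d \<longleftrightarrow> d dvd m" if "d \<le> m"
      using that by (simp add: dvd_minus_self)
    hence "fps_nth (g * lambert_fps d) m = (if m = d then int d else 0)"
      using assms unfolding g_def left_diff_distrib
      by (auto simp: fps_X_power_mult_nth lambert_fps_def dest: dvd_imp_le)
    thus "fps_nth (fps_X * fps_deriv g) m = fps_nth (- (g * lambert_fps d)) m"
      using assms by (auto simp: g_def)
  qed
  moreover have "fps_nth g 0 = 1"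
    using assms by (simp add: g_def)
  ultimately show ?thesis
    unfolding neg_log_deriv_def by blast
qed

text \<open>At index \<open>m\<close> the product \<open>g * P\<close> reduces to the coefficient of
  \<open>P\<close>, as \<open>g\<close> starts with 1, while x g' contributes \<open>m\<close> times
  an integer.\<close>

lemma neg_log_deriv_dvd_first_coeff:
  assumes "neg_log_deriv P" and "\<And>i. i < m \<Longrightarrow> fps_nth P i = 0"
  shows "int m dvd fps_nth P m"
proof -
  obtain g where g: "fps_nth g 0 = 1" "fps_X * fps_deriv g = - (g * P)"
    using assms unfolding neg_log_deriv_def by blast
  have "fps_nth (g * P) m = (\<Sum>i=0..m. fps_nth g i * fps_nth P (m - i))"
    by (simp add: fps_mult_nth)
  also have "\<dots> = (\<Sum>i\<in>{0}. fps_nth g i * fps_nth P (m - i))"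
    by (rule sum.mono_neutral_right) (auto simp: assms(2))
  finally have "fps_nth P m = - fps_nth (fps_X * fps_deriv g) m"
    by (simp add: g)
  also have "\<dots> = - (int m * fps_nth g m)"
    by auto
  finally show ?thesis by simp
qed

text \<open>If \<open>\<phi>\<close> lists the coefficients of \<open>- x f' / f\<close>, these are the exponents in
  \<open>f = \<Prod>\<^sub>d (1 - x\<^sup>d)\<^bsup>c d\<^esup>\<close>; the division by \<open>m\<close> is then exact.\<close>

function euler_exponent :: "(nat \<Rightarrow> int) \<Rightarrow> nat \<Rightarrow> int" where
  "euler_exponent \<phi> m = (\<phi> m - (\<Sum>d | d dvd m \<and> d < m. int d * euler_exponent \<phi> d)) div int m"
  by auto
termination
  by (relation "measure snd") auto

declare euler_exponent.simps [simp del]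

text \<open>Strong induction: removing the contributions of all \<open>d < m\<close> leaves a series
  of the same kind that vanishes below \<open>m\<close>. Its coefficient at \<open>m\<close> is then
  a multiple of \<open>m\<close>, so the division in \<open>euler_exponent\<close> is exact.\<close>

lemma neg_log_deriv_divisor_sum:
  assumes "neg_log_deriv P" and "m > 0"
  shows "fps_nth P m = (\<Sum>d | d dvd m. int d * euler_exponent (fps_nth P) d)"
  using assms(2)
proof (induction m rule: less_induct)
  case (less m)
  let ?c = "euler_exponent (fps_nth P)"
  define Q where "Q = P - (\<Sum>d\<in>{0<..<m}. of_int (?c d) * lambert_fps d)"
  have Q: "neg_log_deriv Q"
    unfolding Q_def
    by (intro neg_log_deriv_diff neg_log_deriv_sum neg_log_deriv_of_int_mult
        neg_log_deriv_lambert_fps assms) auto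
  \<comment> \<open>At index 0 the divisibility reads that 0 divides the constant
    coefficient.\<close>
  have P0: "fps_nth P 0 = 0"
    using neg_log_deriv_dvd_first_coeff[OF assms(1), of 0] by simp
  have nth_Q: "fps_nth Q i = fps_nth P i - (\<Sum>d | d dvd i \<and> d < m. int d * ?c d)"
    if "i > 0" for i
  proof -
    have "fps_nth (of_int (?c d) * lambert_fps d) i = (if d dvd i then int d * ?c d else 0)" for d
      using that by (simp add: fps_of_int[symmetric] lambert_fps_def mult.commute)
    hence "fps_nth Q i = fps_nth P i - (\<Sum>d\<in>{0<..<m}. if d dvd i then int d * ?c d else 0)"
      by (simp add: Q_def fps_sum_nth)
    also have "(\<Sum>d\<in>{0<..<m}. if d dvd i then int d * ?c d else 0)
        = (\<Sum>d | d dvd i \<and> d < m. int d * ?c d)"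
      using that by (intro sum.mono_neutral_cong_right) (auto intro!: Nat.gr0I)
    finally show ?thesis .
  qed
  have "fps_nth Q i = 0" if "i < m" for i
  proof (cases "i = 0")
    case True
    thus ?thesis
      by (simp add: Q_def P0 fps_sum_nth lambert_fps_def fps_of_int[symmetric])
  next
    case False
    have "{d. d dvd i \<and> d < m} = {d. d dvd i}"
      using False that by (auto dest: dvd_imp_le)
    thus ?thesis
      using nth_Q[of i] less.IH[of i] that False by simp
  qed
  hence "int m dvd fps_nth Q m"
    by (intro neg_log_deriv_dvd_first_coeff Q)
  hence "int m * ?c m = fps_nth P m - (\<Sum>d | d dvd m \<and> d < m. int d * ?c d)"
    using less.prems by (simp add: nth_Q euler_exponent.simps[of _ m])
  moreover have "{d. d dvd m} = insert m {d. d dvd m \<and> d < m}"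
    using less.prems by (auto dest: dvd_imp_le)
  ultimately show ?case
    using less.prems by simp
qed

section \<open>Moebius inversion and the congruence\<close>

lemma Phi1_eq_sum_Pow:
  "Phi1 m \<phi> = (\<Sum>S\<in>Pow (prime_factors m). (-1) ^ card S * \<phi> (m div \<Prod>S))"
proof -
  let ?P = "prime_factors m"
  have "(\<Sum>S\<in>Pow ?P. (-1) ^ card S * \<phi> (m div \<Prod>S))
      = (\<Sum>j = 0..card ?P. \<Sum>S | S \<in> Pow ?P \<and> card S = j. (-1) ^ card S * \<phi> (m div \<Prod>S))"
    by (rule sum.group[symmetric]) (auto intro: card_mono)
  also have "\<dots> = Phi1 m \<phi>"
    unfolding Phi1_def sum_distrib_left by (intro sum.cong) auto
  finally show ?thesis by simp
qed

lemma prod_primes_dvd_iff: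
  fixes k :: nat
  assumes "finite S" "\<And>p. p \<in> S \<Longrightarrow> prime p" "k > 0"
  shows "\<Prod>S dvd k \<longleftrightarrow> S \<subseteq> prime_factors k"
proof
  assume *: "\<Prod>S dvd k"
  show "S \<subseteq> prime_factors k"
  proof
    fix p assume "p \<in> S"
    hence "p dvd \<Prod>S"
      using dvd_prodI[OF assms(1), of p "\<lambda>x. x"] by simp
    thus "p \<in> prime_factors k"
      using * assms \<open>p \<in> S\<close> by (auto simp: in_prime_factors_iff intro: dvd_trans)
  qed
next
  assume "S \<subseteq> prime_factors k"
  with assms(1) show "\<Prod>S dvd k"
  proof (induction S rule: finite_induct)
    case (insert p S)
    have "coprime p (\<Prod>S)"
      using insert by (intro prod_coprime_right) (auto intro!: primes_coprime in_prime_factors_imp_prime)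
    thus ?case
      using insert by (auto intro!: divides_mult simp: in_prime_factors_iff)
  qed auto
qed

text \<open>Expand the product of the factors \<open>1 - 1\<close> over \<open>A\<close>.\<close>

lemma sum_Pow_alternating:
  assumes "finite A"
  shows "(\<Sum>S\<in>Pow A. (-1) ^ card S) = (if A = {} then 1 else 0 :: int)"
  using prod_diff_conv_sum[OF assms, of "\<lambda>_. 1 :: int" "\<lambda>_. 1"] assms
  by (simp add: power_0_left)

text \<open>Moebius inversion. The divisors of \<open>m div \<Prod>S\<close> are the divisors
  \<open>d\<close> of \<open>m\<close> for which \<open>S\<close> consists of prime factors of
  \<open>m div d\<close>. After exchanging the sums, the alternating sum over such \<open>S\<close>
  vanishes unless \<open>m div d\<close> has no prime factor, that is, \<open>d = m\<close>.\<close>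

lemma Phi1_divisor_sum:
  assumes "m > 0" and "\<And>k. k > 0 \<Longrightarrow> \<phi> k = (\<Sum>d | d dvd k. F d)"
  shows "Phi1 m \<phi> = F m"
proof -
  let ?P = "prime_factors m"
  have inner: "\<phi> (m div \<Prod>S) = (\<Sum>d | d dvd m. if S \<subseteq> prime_factors (m div d) then F d else 0)"
    if S: "S \<subseteq> ?P" for S
  proof -
    have fin: "finite S" and primes: "\<And>p. p \<in> S \<Longrightarrow> prime p"
      using S finite_subset by (auto intro: in_prime_factors_imp_prime)
    have dvd: "\<Prod>S dvd m"
      using prod_primes_dvd_iff[OF fin primes assms(1)] S by simp
    have pos: "\<Prod>S > 0" "m div \<Prod>S > 0"
      using dvd assms(1) by (auto intro: Nat.gr0I dvd_imp_le simp: div_greater_zero_iff)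
    have "d dvd m div \<Prod>S \<longleftrightarrow> d dvd m \<and> S \<subseteq> prime_factors (m div d)" for d
    proof (cases "d dvd m")
      case True
      hence d: "d > 0" "m div d > 0"
        using assms(1) by (auto intro: Nat.gr0I dvd_imp_le simp: div_greater_zero_iff)
      have "d dvd m div \<Prod>S \<longleftrightarrow> \<Prod>S dvd m div d"
        using d pos dvd True by (simp add: dvd_div_iff_mult mult.commute)
      thus ?thesis
        using True prod_primes_dvd_iff[OF fin primes d(2)] by simp
    next
      case False
      moreover have "m div \<Prod>S dvd m"
        using dvd by (metis dvd_mult_div_cancel dvd_triv_right)
      ultimately show ?thesis
        using dvd_trans by blast
    qed
    hence "\<phi> (m div \<Prod>S) = (\<Sum>d | d dvd m \<and> S \<subseteq> prime_factors (m div d). F d)"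
      using assms(2)[OF pos(2)] by simp
    also have "\<dots> = (\<Sum>d | d dvd m. if S \<subseteq> prime_factors (m div d) then F d else 0)"
      using assms(1) by (intro sum.mono_neutral_cong_left) auto
    finally show ?thesis .
  qed
  have "Phi1 m \<phi> = (\<Sum>S\<in>Pow ?P. \<Sum>d | d dvd m.
      if S \<subseteq> prime_factors (m div d) then (-1) ^ card S * F d else 0)"
    unfolding Phi1_eq_sum_Pow
    by (intro sum.cong refl) (auto simp: inner sum_distrib_left intro!: sum.cong)
  also have "\<dots> = (\<Sum>d | d dvd m. \<Sum>S\<in>Pow ?P.
      if S \<subseteq> prime_factors (m div d) then (-1) ^ card S * F d else 0)"
    by (rule sum.swap)
  also have "\<dots> = (\<Sum>d | d dvd m. if d = m then F d else 0)"
  proof (intro sum.cong refl)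
    fix d assume "d \<in> {d. d dvd m}"
    hence d: "d dvd m" by simp
    have sub: "prime_factors (m div d) \<subseteq> ?P"
      using d assms(1) by (intro dvd_prime_factors) auto
    have "(\<Sum>S\<in>Pow ?P. if S \<subseteq> prime_factors (m div d) then (-1) ^ card S * F d else 0)
        = (\<Sum>S\<in>Pow (prime_factors (m div d)). (-1) ^ card S * F d)"
      using sub by (intro sum.mono_neutral_cong_right) auto
    also have "\<dots> = (if prime_factors (m div d) = {} then 1 else 0) * F d"
      by (simp add: sum_distrib_right[symmetric] sum_Pow_alternating)
    also have "prime_factors (m div d) = {} \<longleftrightarrow> d = m"
      using d assms(1) by (auto simp: prime_factorization_empty_iff elim!: dvdE)
    finally show "(\<Sum>S\<in>Pow ?P. if S \<subseteq> prime_factors (m div d) then (-1) ^ card S * F d else 0)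
        = (if d = m then F d else 0)" by simp
  qed
  also have "\<dots> = F m"
    using assms(1) by simp
  finally show ?thesis .
qed

section \<open>The sequence \<open>phi n\<close> as a negative logarithmic derivative\<close>

lemma phi_eq_sum:
  assumes "n \<le> m"
  shows "phi n m = (\<Sum>j = 1..n - 1. phi n (m - j))"
  using phi_recurrence[of n "m - n"] assms by simp

text \<open>The witness is 1 - x - ... - x^(n-1). Its product with the series of
  \<open>phi n\<close> has zero coefficients from index \<open>n\<close> on by the recurrence, and
  the initial values 2^m - 1 make the lower ones equal to \<open>m\<close>, matching -x g'.\<close>

lemma neg_log_deriv_phi:
  assumes "n > 0"
  shows "neg_log_deriv (Abs_fps (phi n))"
proof -
  define g :: "int fps" where "g = Abs_fps (\<lambda>i. if i = 0 then 1 else if i < n then - 1 else 0)"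
  have "fps_nth (g * Abs_fps (phi n)) m = (if m < n then int m else 0)" for m
  proof -
    have "fps_nth (g * Abs_fps (phi n)) m
        = phi n m + (\<Sum>i = 1..m. (if i < n then - 1 else 0) * phi n (m - i))"
      by (simp add: fps_mult_nth sum.atLeast_Suc_atMost g_def)
    also have "(\<Sum>i = 1..m. (if i < n then - 1 else 0) * phi n (m - i))
        = (\<Sum>i\<in>{1..m} \<inter> {..<n}. - phi n (m - i))"
      by (intro sum.mono_neutral_cong_right) auto
    also have "phi n m + \<dots> = (if m < n then int m else 0)"
    proof (cases "m < n")
      case True
      \<comment> \<open>Index 0 enters here, with the value 2^0 - 1 = 0.\<close>
      have "(\<Sum>i\<in>{1..m} \<inter> {..<n}. phi n (m - i)) = (\<Sum>i<m. phi n i)"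
        using True by (intro sum.reindex_bij_witness[of _ "\<lambda>i. m - i" "\<lambda>i. m - i"]) auto
      also have "\<dots> = (\<Sum>i<m. 2 ^ i - 1)"
        using True by (intro sum.cong refl) (simp add: phi.simps)
      also have "\<dots> = 2 ^ m - 1 - int m"
        by (induction m) auto
      finally show ?thesis
        using True by (simp add: sum_negf phi.simps)
    next
      case False
      hence "{1..m} \<inter> {..<n} = {1..n - 1}"
        using assms by auto
      thus ?thesis
        using False phi_eq_sum[of n m] by (simp add: sum_negf)
    qed
    finally show ?thesis .
  qed
  hence "fps_X * fps_deriv g = - (g * Abs_fps (phi n))"
    by (intro fps_ext) (auto simp: g_def)
  moreover have "fps_nth g 0 = 1"
    by (simp add: g_def)
  ultimately show ?thesis
    unfolding neg_log_deriv_def by blast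
qed

lemma Phi1_phi_eq:
  assumes "n > 0" "m > 0"
  shows "Phi1 m (phi n) = int m * euler_exponent (phi n) m"
proof (rule Phi1_divisor_sum[OF assms(2)])
  have "fps_nth (Abs_fps (phi n)) = phi n"
    by (rule ext) simp
  thus "phi n k = (\<Sum>d | d dvd k. int d * euler_exponent (phi n) d)" if "k > 0" for k
    using neg_log_deriv_divisor_sum[OF neg_log_deriv_phi[OF assms(1)] that] by simp
qed

section \<open>The dominant root\<close>

lemma poly_recurrence_poly:
  assumes "n \<ge> 2"
  shows "poly (recurrence_poly n) x = x ^ (n - 1) - (\<Sum>k<n - 1. x ^ k)"
proof -
  have "{0..n - 2} = {..<n - 1}"
    using assms by auto
  thus ?thesis
    by (simp add: recurrence_poly_def poly_monom poly_sum)
qed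

text \<open>The sum divided by y^d is a sum of negative powers of \<open>y\<close>, hence strictly
  decreasing, and it equals 1 at \<open>x\<close>. This serves both the uniqueness of the positive
  root and the bound on the moduli of complex roots.\<close>

lemma sum_powers_less_power:
  fixes x y :: real
  assumes "0 < x" "x < y" "d > 0" "x ^ d = (\<Sum>k<d. x ^ k)"
  shows "(\<Sum>k<d. y ^ k) < y ^ d"
proof -
  have "x ^ d * y ^ k < y ^ d * x ^ k" if "k < d" for k
  proof -
    have "x ^ (d - k) < y ^ (d - k)"
      using assms that by (intro power_strict_mono) auto
    hence "x ^ k * x ^ (d - k) * y ^ k < y ^ k * y ^ (d - k) * x ^ k"
      using assms by simp
    thus ?thesis
      using that by (simp flip: power_add)
  qed
  hence "(\<Sum>k<d. x ^ d * y ^ k) < (\<Sum>k<d. y ^ d * x ^ k)"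
    using assms(3) by (intro sum_strict_mono) auto
  hence "x ^ d * (\<Sum>k<d. y ^ k) < y ^ d * (\<Sum>k<d. x ^ k)"
    by (simp only: sum_distrib_left)
  also have "\<dots> = x ^ d * y ^ d"
    by (simp only: assms(4) mult.commute)
  finally show ?thesis
    using assms(1) by simp
qed

text \<open>The difference of the two sides is 1 - d at 1 and, by the geometric sum, 1 at 2.\<close>

lemma ex_root_sum_powers:
  assumes "d \<ge> 2"
  shows "\<exists>x::real. x > 1 \<and> x ^ d = (\<Sum>k<d. x ^ k)"
proof -
  let ?f = "\<lambda>x::real. x ^ d - (\<Sum>k<d. x ^ k)"
  have "\<exists>x. 1 \<le> x \<and> x \<le> 2 \<and> ?f x = 0"
  proof (rule IVT')
    show "?f 1 \<le> 0"
      using assms by simp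
    show "0 \<le> ?f 2"
      using sum_gp_strict[of "2 :: real" d] by simp
  qed (auto intro!: continuous_intros)
  then obtain x where x: "x \<ge> 1" "?f x = 0" by blast
  moreover have "x \<noteq> 1"
    using x assms by auto
  ultimately show ?thesis
    by (intro exI[of _ x]) auto
qed

text \<open>Equality of norms in the triangle inequality forces \<open>1\<close> and \<open>z\<close> to be aligned.\<close>
lemma complex_root_sum_powers:
  fixes z :: complex
  assumes "d \<ge> 2" "x > 0" "x ^ d = (\<Sum>k<d. x ^ k)" "z ^ d = (\<Sum>k<d. z ^ k)" "z \<noteq> of_real x"
  shows "cmod z < x"
proof (rule ccontr)
  assume "\<not> cmod z < x"
  \<comment> \<open>Keeping 1 + z together while estimating the other terms retains what is needed
    once the modulus is known to be \<open>x\<close>.\<close>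
  have split: "(\<Sum>k<d. y ^ k) = 1 + y + (\<Sum>k\<in>{2..<d}. y ^ k)" for y :: "'a :: comm_ring_1"
  proof -
    have "{..<d} = {0, 1} \<union> {2..<d}"
      using assms(1) by auto
    thus ?thesis
      by (simp add: sum.union_disjoint)
  qed
  have "cmod z ^ d = cmod (\<Sum>k<d. z ^ k)"
    by (metis assms(4) norm_power)
  also have "\<dots> \<le> cmod (1 + z) + (\<Sum>k\<in>{2..<d}. cmod z ^ k)"
    unfolding split by (intro norm_triangle_mono norm_sum[THEN order_trans]) (auto simp: norm_power)
  finally have upper: "cmod z ^ d \<le> cmod (1 + z) + (\<Sum>k\<in>{2..<d}. cmod z ^ k)" .
  also have "\<dots> \<le> (\<Sum>k<d. cmod z ^ k)"
    using norm_triangle_ineq[of 1 z] by (simp add: split)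
  \<comment> \<open>Beyond \<open>x\<close> the power strictly exceeds the sum, contrary to the
    bound just obtained.\<close>
  finally have "\<not> x < cmod z"
    using sum_powers_less_power[of x "cmod z" d] assms by auto
  with \<open>\<not> cmod z < x\<close> have norm_z: "cmod z = x" by simp
  have "1 + x \<le> cmod (1 + z)"
    using upper assms(3) by (simp add: norm_z split)
  hence "(1 + x)\<^sup>2 \<le> (cmod (1 + z))\<^sup>2"
    using assms(2) by (intro power_mono) auto
  also have "\<dots> = 1 + 2 * Re z + (cmod z)\<^sup>2"
    unfolding cmod_power2 by (simp add: power2_eq_square algebra_simps)
  finally have "x \<le> Re z"
    by (simp add: norm_z power2_eq_square algebra_simps)
  with norm_z assms(2) have "Re z = x"
    using complex_Re_le_cmod[of z] by simp
  with norm_z have "Im z = 0"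
    using cmod_power2[of z] by simp
  with \<open>Re z = x\<close> assms(5) show False
    by (simp add: complex_eq_iff)
qed

section \<open>Growth rates\<close>

text \<open>For d = n - 1 this is the recurrence of \<open>phi n\<close>, so powers of the root can
  be compared with \<open>phi n\<close> by induction.\<close>

lemma power_eq_sum_previous:
  fixes x :: real
  assumes "x ^ d = (\<Sum>k<d. x ^ k)" "d \<le> m"
  shows "x ^ m = (\<Sum>j = 1..d. x ^ (m - j))"
proof -
  have "x ^ m = x ^ (m - d) * x ^ d"
    using assms(2) by (simp flip: power_add)
  also have "\<dots> = (\<Sum>k<d. x ^ (m - d + k))"
    by (simp add: assms(1) sum_distrib_left power_add)
  also have "\<dots> = (\<Sum>j = 1..d. x ^ (m - j))"
    using assms(2) by (intro sum.reindex_bij_witness[of _ "\<lambda>j. d - j" "\<lambda>k. d - k"]) auto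
  finally show ?thesis .
qed

text \<open>Both sequences obey one recurrence with nonnegative coefficients, so bounds on the
  initial window \<open>m < n\<close> propagate. The constants come from that window, where 1 \<le>
  2^m - 1 and x^m \<le> x^n, and where 2^m \<le> 2^n and 1 \<le> x^m.\<close>

lemma phi_bounds:
  fixes x :: real
  assumes "n > 0" "x \<ge> 1" "x ^ (n - 1) = (\<Sum>k<n - 1. x ^ k)" "m > 0"
  shows "x ^ m \<le> x ^ n * phi n m \<and> phi n m \<le> 2 ^ n * x ^ m"
  using assms(4)
proof (induction m rule: less_induct)
  case (less m)
  show ?case
  proof (cases "m < n")
    case True
    have "(1 :: real) \<le> 2 ^ m - 1"
      using less.prems power_increasing[of 1 m "2::real"] by simp
    hence "x ^ n * 1 \<le> x ^ n * (2 ^ m - 1)"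
      using assms(2) by (intro mult_left_mono) auto
    moreover have "x ^ m \<le> x ^ n"
      using True assms(2) by (intro power_increasing) auto
    moreover have "(2::real) ^ m * 1 \<le> 2 ^ n * x ^ m"
      using True assms(2) by (intro mult_mono power_increasing) auto
    ultimately show ?thesis
      using True by (simp add: phi.simps)
  next
    case False
    have phi: "real_of_int (phi n m) = (\<Sum>j = 1..n - 1. real_of_int (phi n (m - j)))"
      using False phi_eq_sum[of n m] by simp
    have pow: "x ^ m = (\<Sum>j = 1..n - 1. x ^ (m - j))"
      using assms(3) False by (intro power_eq_sum_previous) auto
    have IH: "x ^ (m - j) \<le> x ^ n * phi n (m - j) \<and> phi n (m - j) \<le> 2 ^ n * x ^ (m - j)"
      if "j \<in> {1..n - 1}" for j
      using that False assms(1) by (intro less.IH) auto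
    have "x ^ m \<le> x ^ n * phi n m"
      unfolding phi pow sum_distrib_left using IH by (intro sum_mono) blast
    moreover have "phi n m \<le> 2 ^ n * x ^ m"
      unfolding phi pow sum_distrib_left using IH by (intro sum_mono) blast
    ultimately show ?thesis by blast
  qed
qed

text \<open>Every term with \<open>S \<noteq> {}\<close> has argument at most \<open>m / 2\<close>, and there are at most
  \<open>2 ^ card (prime_factors m) \<le> m\<close> terms.\<close>
lemma abs_Phi1_diff_le:
  fixes C x :: real
  assumes "m > 0" "x \<ge> 1" "\<And>k. k > 0 \<Longrightarrow> \<bar>real_of_int (\<phi> k)\<bar> \<le> C * x ^ k"
  shows "\<bar>real_of_int (Phi1 m \<phi>) - real_of_int (\<phi> m)\<bar> \<le> real m * C * x ^ (m div 2)"
proof -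
  let ?P = "prime_factors m"
  have "0 \<le> C * x"
    using assms(3)[of 1] by simp
  hence C: "C \<ge> 0"
    using assms(2) by (simp add: zero_le_mult_iff)
  have "Phi1 m \<phi> = \<phi> m + (\<Sum>S\<in>Pow ?P - {{}}. (-1) ^ card S * \<phi> (m div \<Prod>S))"
    unfolding Phi1_eq_sum_Pow by (subst sum.remove[of _ "{}"]) auto
  hence "\<bar>real_of_int (Phi1 m \<phi>) - real_of_int (\<phi> m)\<bar>
      = \<bar>\<Sum>S\<in>Pow ?P - {{}}. (-1) ^ card S * real_of_int (\<phi> (m div \<Prod>S))\<bar>"
    by simp
  also have "\<dots> \<le> (\<Sum>S\<in>Pow ?P - {{}}. \<bar>(-1) ^ card S * real_of_int (\<phi> (m div \<Prod>S))\<bar>)"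
    by (rule sum_abs)
  also have "\<dots> \<le> (\<Sum>S\<in>Pow ?P - {{}}. C * x ^ (m div 2))"
  proof (rule sum_mono)
    fix S assume S: "S \<in> Pow ?P - {{}}"
    have fin: "finite S" and primes: "\<And>p. p \<in> S \<Longrightarrow> prime p"
      using S finite_subset by (auto intro: in_prime_factors_imp_prime)
    obtain p where p: "p \<in> S" "prime p"
      using S primes by blast
    have dvd: "\<Prod>S dvd m"
      using prod_primes_dvd_iff[OF fin primes assms(1)] S by simp
    have pos: "\<Prod>S > 0" "m div \<Prod>S > 0"
      using dvd assms(1) by (auto intro: Nat.gr0I dvd_imp_le simp: div_greater_zero_iff)
    have "p dvd \<Prod>S"
      using dvd_prodI[OF fin p(1), of "\<lambda>x. x"] by simp
    hence "p \<le> \<Prod>S"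
      using pos by (intro dvd_imp_le) auto
    hence "2 \<le> \<Prod>S"
      using prime_ge_2_nat[OF p(2)] by linarith
    hence "m div \<Prod>S \<le> m div 2"
      by (intro div_le_mono2) auto
    hence "C * x ^ (m div \<Prod>S) \<le> C * x ^ (m div 2)"
      using assms(2) C by (intro mult_left_mono power_increasing) auto
    thus "\<bar>(-1) ^ card S * real_of_int (\<phi> (m div \<Prod>S))\<bar> \<le> C * x ^ (m div 2)"
      using assms(3)[OF pos(2)] by (simp add: abs_mult)
  qed
  also have "\<dots> = real (card (Pow ?P - {{}})) * (C * x ^ (m div 2))"
    by simp
  also have "\<dots> \<le> real m * (C * x ^ (m div 2))"
  proof (rule mult_right_mono)
    \<comment> \<open>Replacing each factor 2 by a prime factor leads to the radical of
      \<open>m\<close>, which divides \<open>m\<close>.\<close>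
    have "card (Pow ?P - {{}}) \<le> card (Pow ?P)"
      by (intro card_mono) auto
    also have "\<dots> = (\<Prod>p\<in>?P. 2)"
      by (simp add: card_Pow)
    also have "\<dots> \<le> \<Prod>?P"
      by (intro prod_mono) (auto intro: prime_ge_2_nat)
    also have "\<dots> \<le> m"
    proof (rule dvd_imp_le)
      show "\<Prod>?P dvd m"
        using assms(1) by (subst prod_primes_dvd_iff) (auto intro: in_prime_factors_imp_prime)
    qed (rule assms(1))
    finally show "real (card (Pow ?P - {{}})) \<le> real m" by simp
  qed (use C assms(2) in auto)
  finally show ?thesis by (simp add: mult.assoc)
qed

text \<open>A constant factor only adds a term ln c / m, which tends to 0, so both bounds have the
  same limit.\<close>

lemma growth_rate_limit:
  fixes u :: "nat \<Rightarrow> real"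
  assumes "a > 0" "x > 0"
    and "\<forall>\<^sub>F m in sequentially. a * x ^ m \<le> u m \<and> u m \<le> b * x ^ m"
  shows "(\<lambda>m. ln (u m) / real m) \<longlonglongrightarrow> ln x"
proof (rule tendsto_sandwich)
  have lim: "(\<lambda>m. (ln c + real m * ln x) / real m) \<longlonglongrightarrow> ln x" for c :: real
    by real_asymp
  show "(\<lambda>m. (ln a + real m * ln x) / real m) \<longlonglongrightarrow> ln x"
    "(\<lambda>m. (ln b + real m * ln x) / real m) \<longlonglongrightarrow> ln x"
    by (rule lim)+
  have main: "ln a + real m * ln x \<le> ln (u m) \<and> ln (u m) \<le> ln b + real m * ln x"
    if "a * x ^ m \<le> u m \<and> u m \<le> b * x ^ m" for m
  proof -
    have "0 < a * x ^ m"
      using assms by simp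
    with that have pos: "0 < u m" "0 < b * x ^ m" by linarith+
    hence "b > 0"
      using assms(2) by (simp add: zero_less_mult_iff)
    have "ln (a * x ^ m) \<le> ln (u m)" "ln (u m) \<le> ln (b * x ^ m)"
      using that pos \<open>0 < a * x ^ m\<close> by simp_all
    thus ?thesis
      using assms \<open>b > 0\<close> by (simp add: ln_mult ln_realpow)
  qed
  show "\<forall>\<^sub>F m in sequentially. (ln a + real m * ln x) / real m \<le> ln (u m) / real m"
    using assms(3) by eventually_elim (use main in \<open>auto intro: divide_right_mono\<close>)
  show "\<forall>\<^sub>F m in sequentially. ln (u m) / real m \<le> (ln b + real m * ln x) / real m"
    using assms(3) by eventually_elim (use main in \<open>auto intro: divide_right_mono\<close>)
qed

lemma eventually_linear_mult_power_half_le: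
  fixes x C \<epsilon> :: real
  assumes "x > 1" "C > 0" "\<epsilon> > 0"
  shows "\<forall>\<^sub>F m in sequentially. real m * C * x ^ (m div 2) \<le> \<epsilon> * x ^ m"
proof -
  \<comment> \<open>The real exponent m/2 makes this a plain asymptotic comparison; rounding down to
    \<open>m div 2\<close> only decreases the left side.\<close>
  have "\<forall>\<^sub>F m in sequentially. real m * C * x powr (real m / 2) \<le> \<epsilon> * x powr real m"
    using assms by real_asymp
  thus ?thesis
  proof eventually_elim
    case (elim m)
    have "x ^ (m div 2) = x powr real (m div 2)"
      using assms by (simp add: powr_realpow)
    also have "\<dots> \<le> x powr (real m / 2)"
      using assms by (intro powr_mono) linarith+
    finally have "real m * C * x ^ (m div 2) \<le> real m * C * x powr (real m / 2)"
      using assms by (intro mult_left_mono) auto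
    with elim show ?case
      using assms by (simp add: powr_realpow)
  qed
qed

text \<open>Eventual positivity is included because \<open>ln\<close> is total: it ensures that the
  limits concern genuine logarithms.\<close>

theorem theorem3:
  fixes n :: nat
  assumes "n \<ge> 3"
  shows "(\<forall>m::nat. m > 0 \<longrightarrow> [Phi1 m (phi n) = 0] (mod int m)) \<and>
    (\<forall>\<^sub>F m in sequentially. Phi1 m (phi n) > 0 \<and> phi n m > 0) \<and>
    (\<exists>\<alpha>::real.
       \<alpha> > 0 \<and> poly (recurrence_poly n) \<alpha> = 0 \<and>
       (\<forall>x::real. x > 0 \<and> poly (recurrence_poly n) x = 0 \<longrightarrow> x = \<alpha>) \<and>
       (\<forall>z::complex. poly (recurrence_poly n) z = 0 \<and> z \<noteq> of_real \<alpha> \<longrightarrow> cmod z < \<alpha>) \<and>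
       (\<lambda>m. ln (real_of_int (Phi1 m (phi n))) / real m) \<longlonglongrightarrow> ln \<alpha> \<and>
       (\<lambda>m. ln (real_of_int (phi n m)) / real m) \<longlonglongrightarrow> ln \<alpha>)"
proof -
  obtain \<alpha> :: real where \<alpha>: "\<alpha> > 1" "\<alpha> ^ (n - 1) = (\<Sum>k<n - 1. \<alpha> ^ k)"
  proof -
    have "n - 1 \<ge> 2"
      using assms by simp
    from ex_root_sum_powers[OF this] show ?thesis
      using that by blast
  qed
  note poly = poly_recurrence_poly[of n]
  define C :: real where "C = 2 ^ n"
  define c :: real where "c = 1 / \<alpha> ^ n"
  have c: "c > 0" and C: "C > 0"
    using \<alpha> by (auto simp: c_def C_def)
  have phi: "c * \<alpha> ^ m \<le> phi n m" "phi n m \<le> C * \<alpha> ^ m" if "m > 0" for m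
    using phi_bounds[of n \<alpha> m] \<alpha> that assms by (auto simp: c_def C_def field_simps)
  have phi_pos: "phi n m > 0" if "m > 0" for m
  proof -
    have "0 < c * \<alpha> ^ m"
      using c \<alpha>(1) by simp
    with phi(1)[OF that] show ?thesis by linarith
  qed
  have diff: "\<bar>real_of_int (Phi1 m (phi n)) - phi n m\<bar> \<le> real m * C * \<alpha> ^ (m div 2)" if "m > 0" for m
    using that \<alpha> phi(2) phi_pos by (intro abs_Phi1_diff_le) (auto simp: abs_of_pos)
  \<comment> \<open>Allowing the error only half of the lower constant \<open>c\<close> leaves a
    positive lower bound for \<open>Phi1\<close>.\<close>
  have "\<forall>\<^sub>F m in sequentially. real m * C * \<alpha> ^ (m div 2) \<le> c / 2 * \<alpha> ^ m"
    using \<alpha>(1) C c by (intro eventually_linear_mult_power_half_le) auto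
  hence Phi1: "\<forall>\<^sub>F m in sequentially.
      c / 2 * \<alpha> ^ m \<le> Phi1 m (phi n) \<and> Phi1 m (phi n) \<le> (C + c / 2) * \<alpha> ^ m"
    using eventually_gt_at_top[of 0]
  proof eventually_elim
    case (elim m)
    have "\<bar>real_of_int (Phi1 m (phi n)) - phi n m\<bar> \<le> c / 2 * \<alpha> ^ m"
      using diff[OF elim(2)] elim(1) by linarith
    moreover have "(C + c / 2) * \<alpha> ^ m = C * \<alpha> ^ m + c / 2 * \<alpha> ^ m"
      by (rule distrib_right)
    moreover have "c * \<alpha> ^ m = c / 2 * \<alpha> ^ m + c / 2 * \<alpha> ^ m"
      by simp
    ultimately show ?case
      using phi[OF elim(2)] by linarith
  qed
  have Phi1_pos: "\<forall>\<^sub>F m in sequentially. Phi1 m (phi n) > 0 \<and> phi n m > 0"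
    using Phi1 eventually_gt_at_top[of 0]
  proof eventually_elim
    case (elim m)
    have "0 < c / 2 * \<alpha> ^ m"
      using c \<alpha>(1) by simp
    hence "0 < real_of_int (Phi1 m (phi n))"
      using elim by linarith
    thus ?case
      using phi_pos[OF elim(2)] by simp
  qed
  \<comment> \<open>Of two positive roots, the larger would have its power strictly above the
    sum.\<close>
  have unique: "x = \<alpha>" if "x > 0" "poly (recurrence_poly n) x = 0" for x :: real
    using that sum_powers_less_power[of x \<alpha> "n - 1"] sum_powers_less_power[of \<alpha> x "n - 1"] \<alpha> assms
    by (cases x \<alpha> rule: linorder_cases) (auto simp: poly)
  have complex: "cmod z < \<alpha>" if "poly (recurrence_poly n) z = 0" "z \<noteq> of_real \<alpha>" for z
    using that \<alpha> assms by (intro complex_root_sum_powers[of "n - 1"]) (auto simp: poly)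
  have limit_Phi1: "(\<lambda>m. ln (real_of_int (Phi1 m (phi n))) / real m) \<longlonglongrightarrow> ln \<alpha>"
    using c \<alpha>(1) by (intro growth_rate_limit[OF _ _ Phi1]) auto
  have "\<forall>\<^sub>F m in sequentially. c * \<alpha> ^ m \<le> phi n m \<and> phi n m \<le> C * \<alpha> ^ m"
    using eventually_gt_at_top[of 0] by eventually_elim (use phi in auto)
  hence limit_phi: "(\<lambda>m. ln (real_of_int (phi n m)) / real m) \<longlonglongrightarrow> ln \<alpha>"
    using c \<alpha>(1) by (intro growth_rate_limit) auto
  have "[Phi1 m (phi n) = 0] (mod int m)" if "m > 0" for m
    using that assms by (simp add: Phi1_phi_eq cong_0_iff)
  moreover have "\<alpha> > 0" "poly (recurrence_poly n) \<alpha> = 0"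
    using \<alpha> assms by (auto simp: poly)
  ultimately show ?thesis
    using Phi1_pos unique complex limit_Phi1 limit_phi by blast
qed

end
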